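(* Let $r, r_1,\dots,r_q$ be non-negative integers ($q\ge 0$), let $S$ be a finite ground set with $|S|\ge r$, and let $\mathcal{H}=\{H_1,\dots,H_q\}$ be a (possibly empty) collection of subsets of $S$ such that $$|H_i\cap H_j|\le r_i+r_j-r\quad\text{for all } 1\le i<j\le q.$$ Then $\mathcal{I}=\{X\subseteq S \mid |X|\le r,\ |X\cap H_i|\le r_i \text{ for } 1\le i\le q\}$ is the family of independent sets of a matroid $M$ on $S$, and its rank function is given by $$r_M(Z)=\min\Big\{r,\ |Z|,\ \min_{1\le i\le q}\{|Z-H_i|+r_i\}\Big\}\qquad (Z\subseteq S).$$ If furthermore $|S-H_i|+r_i\ge r$ holds for all $i=1,\dots,q$, then the rank of the matroid $M$ is $r$.
   Context: $X-Y$ denotes set difference. When $q=0$ the inner minimum over the empty index set is omitted (taken as $+\infty$). *)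

theory Defs
  imports Main
begin

locale matroid =
  fixes S :: "'a set" and indep_sets :: "'a set set"
  assumes finite_ground: "finite S"
    and indep_subset: "X \<in> indep_sets \<Longrightarrow> X \<subseteq> S"
    and indep_empty: "{} \<in> indep_sets"
    and indep_hereditary: "X \<in> indep_sets \<Longrightarrow> Y \<subseteq> X \<Longrightarrow> Y \<in> indep_sets"
    and indep_augment:
      "X \<in> indep_sets \<Longrightarrow> Y \<in> indep_sets \<Longrightarrow> card X < card Y \<Longrightarrow>
        \<exists>y \<in> Y - X. insert y X \<in> indep_sets"

text \<open>The maximum below ranges over a finite nonempty set when the family is that of a
  matroid. The rank of the matroid itself is the value at its ground set.\<close>

definition matroid_rank :: "'a set set \<Rightarrow> 'a set \<Rightarrow> nat" where
  "matroid_rank indep_sets Z = Max (card ` {X \<in> indep_sets. X \<subseteq> Z})"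

end

theory Submission imports Defs
begin

text \<open>
  Every independent subset of \<open>Z\<close> has size at most each of the numbers \<open>r\<close>, \<open>|Z|\<close> and
  \<open>|Z - H\<^sub>i| + r\<^sub>i\<close>; this needs no assumption on the sets \<open>H\<^sub>i\<close> (\<open>card_le_rank_bound\<close>). The whole theorem follows once
  every inclusion-maximal independent subset \<open>X\<close> of \<open>Z\<close> is known to attain one of these bounds
  (\<open>card_maximal_in_rank_bounds\<close>):
  the bounds then give the rank, and an independent set \<open>X\<close> that no element of an independent
  set \<open>Y\<close> augments is maximal in \<open>X \<union> Y\<close>, hence at least as large as \<open>Y\<close>.

  Let \<open>X\<close> be maximal in \<open>Z\<close> with \<open>|X| < r\<close> and \<open>X \<noteq> Z\<close>. Each \<open>z \<in> Z - X\<close> lies in some \<open>H\<^sub>i\<close> that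
  is tight, meaning \<open>|X \<inter> H\<^sub>i| = r\<^sub>i\<close>. Two different tight indices \<open>i\<close>, \<open>j\<close> would give
  \<open>|X| \<ge> |X \<inter> (H\<^sub>i \<union> H\<^sub>j)| \<ge> r\<^sub>i + r\<^sub>j - |H\<^sub>i \<inter> H\<^sub>j| \<ge> r\<close>, so exactly one index \<open>i\<close> is tight, and
  \<open>Z - X \<subseteq> H\<^sub>i\<close>. Thus \<open>Z - H\<^sub>i = X - H\<^sub>i\<close> and \<open>|X| = |Z - H\<^sub>i| + r\<^sub>i\<close>.
\<close>

text \<open>The sets of size at most \<open>r\<close> that meet each \<open>H i\<close>, for \<open>i\<close> in the index set \<open>J\<close>, in at most
  \<open>c i\<close> elements.\<close>

definition capped_sets ::
    "'a set \<Rightarrow> nat \<Rightarrow> 'i set \<Rightarrow> ('i \<Rightarrow> 'a set) \<Rightarrow> ('i \<Rightarrow> nat) \<Rightarrow> 'a set set" where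
  "capped_sets S r J H c =
    {X. X \<subseteq> S \<and> card X \<le> r \<and> (\<forall>i\<in>J. card (X \<inter> H i) \<le> c i)}"

text \<open>The numbers whose minimum is the rank of \<open>Z\<close>. Putting them into one set takes care of the
  empty index set.\<close>

definition rank_bounds ::
    "nat \<Rightarrow> 'i set \<Rightarrow> ('i \<Rightarrow> 'a set) \<Rightarrow> ('i \<Rightarrow> nat) \<Rightarrow> 'a set \<Rightarrow> nat set" where
  "rank_bounds r J H c Z = {r, card Z} \<union> (\<lambda>i. card (Z - H i) + c i) ` J"

lemma capped_setsI:
  assumes "X \<subseteq> S" "card X \<le> r" "\<And>i. i \<in> J \<Longrightarrow> card (X \<inter> H i) \<le> c i"
  shows "X \<in> capped_sets S r J H c"
  using assms by (simp add: capped_sets_def)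

lemma capped_setsD:
  assumes "X \<in> capped_sets S r J H c"
  shows "X \<subseteq> S" "card X \<le> r" "\<And>i. i \<in> J \<Longrightarrow> card (X \<inter> H i) \<le> c i"
  using assms by (simp_all add: capped_sets_def)

lemma capped_sets_hereditary:
  assumes "finite S" and X: "X \<in> capped_sets S r J H c" and "Y \<subseteq> X"
  shows "Y \<in> capped_sets S r J H c"
proof (rule capped_setsI)
  have "finite X" using assms(1) capped_setsD(1)[OF X] by (rule rev_finite_subset)
  then show "card Y \<le> r"
    using card_mono[OF _ \<open>Y \<subseteq> X\<close>] capped_setsD(2)[OF X] by linarith
  fix i assume "i \<in> J"
  have "card (Y \<inter> H i) \<le> card (X \<inter> H i)"
    using \<open>finite X\<close> \<open>Y \<subseteq> X\<close> by (intro card_mono) auto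
  then show "card (Y \<inter> H i) \<le> c i"
    using capped_setsD(3)[OF X \<open>i \<in> J\<close>] by linarith
next
  show "Y \<subseteq> S" using \<open>Y \<subseteq> X\<close> capped_setsD(1)[OF X] by blast
qed

lemma card_le_rank_bound:
  assumes "finite Z" and Y: "Y \<in> capped_sets S r J H c" and "Y \<subseteq> Z"
    and b: "b \<in> rank_bounds r J H c Z"
  shows "card Y \<le> b"
proof -
  have "card Y \<le> card (Z - H i) + c i" if "i \<in> J" for i
  proof -
    have "finite Y" using assms(1,3) by (metis finite_subset)
    have "card Y = card (Y \<inter> H i) + card (Y - H i)"
      using \<open>finite Y\<close> by (rule card_Int_Diff)
    also have "\<dots> \<le> c i + card (Z - H i)"
      using capped_setsD(3)[OF Y that] assms(1,3) by (intro add_mono card_mono) auto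
    finally show ?thesis by simp
  qed
  then show ?thesis
    using b capped_setsD(2)[OF Y] card_mono[OF assms(1,3)] by (auto simp: rank_bounds_def)
qed

lemma card_ge_of_two_traces:
  assumes "finite X" and "finite (A \<inter> B)"
    and "r + card (A \<inter> B) \<le> card (X \<inter> A) + card (X \<inter> B)"
  shows "r \<le> card X"
proof -
  have "card (X \<inter> A) + card (X \<inter> B) = card (X \<inter> (A \<union> B)) + card (X \<inter> (A \<inter> B))"
    using card_Un_Int[of "X \<inter> A" "X \<inter> B"] \<open>finite X\<close>
    by (simp add: Int_Un_distrib Int_ac)
  moreover have "card (X \<inter> (A \<union> B)) \<le> card X" "card (X \<inter> (A \<inter> B)) \<le> card (A \<inter> B)"
    using assms by (auto intro: card_mono)
  ultimately show ?thesis using assms by linarith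
qed

text \<open>The only place where the overlap condition on the sets \<open>H i\<close> enters. It is stated without
  subtraction, as \<open>r + |H\<^sub>i \<inter> H\<^sub>j| \<le> c\<^sub>i + c\<^sub>j\<close>, and symmetrically in \<open>i\<close> and \<open>j\<close>.\<close>

lemma card_maximal_in_rank_bounds:
  assumes "finite S" and "Z \<subseteq> S" and HS: "\<And>i. i \<in> J \<Longrightarrow> H i \<subseteq> S"
    and overlap: "\<And>i j. i \<in> J \<Longrightarrow> j \<in> J \<Longrightarrow> i \<noteq> j \<Longrightarrow> r + card (H i \<inter> H j) \<le> c i + c j"
    and X: "X \<in> capped_sets S r J H c" and "X \<subseteq> Z"
    and maximal: "\<And>z. z \<in> Z - X \<Longrightarrow> insert z X \<notin> capped_sets S r J H c"
  shows "card X \<in> rank_bounds r J H c Z"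
proof (cases "card X = r \<or> X = Z")
  case True
  then show ?thesis by (auto simp: rank_bounds_def)
next
  case False
  have finX: "finite X" using assms(1) capped_setsD(1)[OF X] by (rule rev_finite_subset)
  have less: "card X < r" using False capped_setsD(2)[OF X] by simp
  have blocked: "\<exists>i\<in>J. z \<in> H i \<and> card (X \<inter> H i) = c i" if z: "z \<in> Z - X" for z
  proof -
    have "\<exists>i\<in>J. \<not> card (insert z X \<inter> H i) \<le> c i"
    proof (rule ccontr)
      assume "\<not> ?thesis"
      then have "insert z X \<in> capped_sets S r J H c"
        using z \<open>X \<subseteq> Z\<close> \<open>Z \<subseteq> S\<close> finX less by (intro capped_setsI) auto
      then show False using maximal[OF z] by blast
    qed
    then obtain i where i: "i \<in> J" "c i < card (insert z X \<inter> H i)" by force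
    have le: "card (X \<inter> H i) \<le> c i" by (rule capped_setsD(3)[OF X i(1)])
    have "z \<in> H i"
    proof (rule ccontr)
      assume "z \<notin> H i"
      then show False using i(2) le by simp
    qed
    then have "card (insert z X \<inter> H i) = Suc (card (X \<inter> H i))"
      using z finX by simp
    then have "card (X \<inter> H i) = c i" using i(2) le by linarith
    then show ?thesis using i(1) \<open>z \<in> H i\<close> by blast
  qed
  obtain z where "z \<in> Z - X" using False \<open>X \<subseteq> Z\<close> by blast
  then obtain i where i: "i \<in> J" "card (X \<inter> H i) = c i" using blocked by blast
  have "Z - X \<subseteq> H i"
  proof
    fix y assume "y \<in> Z - X"
    then obtain j where j: "j \<in> J" "y \<in> H j" "card (X \<inter> H j) = c j" using blocked by blast
    \<comment> \<open>Two different tight sets would force \<open>card X \<ge> r\<close>.\<close>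
    have "i = j"
    proof (rule ccontr)
      assume "i \<noteq> j"
      then have "r + card (H i \<inter> H j) \<le> card (X \<inter> H i) + card (X \<inter> H j)"
        using overlap i j by simp
      moreover have "finite (H i \<inter> H j)"
        using HS[OF i(1)] \<open>finite S\<close> by (meson finite_Int finite_subset)
      ultimately show False using card_ge_of_two_traces[OF finX] less by (meson not_le)
    qed
    then show "y \<in> H i" using j(2) by simp
  qed
  then have "Z - H i = X - H i" using \<open>X \<subseteq> Z\<close> by blast
  then have "card X = card (Z - H i) + c i"
    using card_Int_Diff[OF finX, of "H i"] i(2) by simp
  then show ?thesis using i(1) by (auto simp: rank_bounds_def)
qed

lemma matroid_capped_sets:
  assumes "finite S" and "\<And>i. i \<in> J \<Longrightarrow> H i \<subseteq> S"
    and "\<And>i j. i \<in> J \<Longrightarrow> j \<in> J \<Longrightarrow> i \<noteq> j \<Longrightarrow> r + card (H i \<inter> H j) \<le> c i + c j"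
  shows "matroid S (capped_sets S r J H c)"
proof
  show "{} \<in> capped_sets S r J H c" by (simp add: capped_sets_def)
  show "Y \<in> capped_sets S r J H c"
    if "X \<in> capped_sets S r J H c" "Y \<subseteq> X" for X Y
    using capped_sets_hereditary[OF assms(1) that] .
  show "\<exists>y\<in>Y - X. insert y X \<in> capped_sets S r J H c"
    if X: "X \<in> capped_sets S r J H c" and Y: "Y \<in> capped_sets S r J H c"
      and less: "card X < card Y" for X Y
  proof (rule ccontr)
    assume no: "\<not> ?thesis"
    have XY: "X \<union> Y \<subseteq> S" using capped_setsD(1)[OF X] capped_setsD(1)[OF Y] by blast
    have "card X \<in> rank_bounds r J H c (X \<union> Y)"
      using no by (intro card_maximal_in_rank_bounds[OF assms(1) XY assms(2,3) X]) auto
    then have "card Y \<le> card X"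
      using card_le_rank_bound[OF finite_subset[OF XY assms(1)] Y] by blast
    then show False using less by simp
  qed
qed (use assms(1) in \<open>auto simp: capped_sets_def\<close>)

lemma matroid_rank_capped_sets:
  assumes "finite S" and "finite J" and "Z \<subseteq> S" and "\<And>i. i \<in> J \<Longrightarrow> H i \<subseteq> S"
    and "\<And>i j. i \<in> J \<Longrightarrow> j \<in> J \<Longrightarrow> i \<noteq> j \<Longrightarrow> r + card (H i \<inter> H j) \<le> c i + c j"
  shows "matroid_rank (capped_sets S r J H c) Z = Min (rank_bounds r J H c Z)"
proof -
  define F where "F = {X \<in> capped_sets S r J H c. X \<subseteq> Z}"
  have finZ: "finite Z" using assms(1,3) by (metis finite_subset)
  have finF: "finite F"
    by (rule finite_subset[of _ "Pow Z"]) (auto simp: F_def finZ)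
  have "{} \<in> F" by (simp add: F_def capped_sets_def)
  then obtain X where X: "X \<in> F" and max: "\<And>Y. Y \<in> F \<Longrightarrow> X \<subseteq> Y \<Longrightarrow> X = Y"
    using finite_has_maximal[OF finF] by blast
  have attained: "card X \<in> rank_bounds r J H c Z"
  proof (rule card_maximal_in_rank_bounds[OF assms(1,3,4,5)])
    show "X \<in> capped_sets S r J H c" "X \<subseteq> Z" using X by (auto simp: F_def)
    show "insert z X \<notin> capped_sets S r J H c" if "z \<in> Z - X" for z
      using max[of "insert z X"] that X by (auto simp: F_def)
  qed
  have bound: "card Y \<le> b" if "Y \<in> F" "b \<in> rank_bounds r J H c Z" for Y b
    using card_le_rank_bound[OF finZ _ _ that(2)] that(1) by (auto simp: F_def)
  have "Max (card ` F) = card X"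
    using finF X bound[OF _ attained] by (intro Max_eqI) auto
  moreover have "Min (rank_bounds r J H c Z) = card X"
    using assms(2) bound[OF X] attained by (intro Min_eqI) (auto simp: rank_bounds_def)
  ultimately show ?thesis by (simp add: matroid_rank_def F_def)
qed

theorem theorem6:
  fixes S :: "'a set" and r q :: nat
    and H :: "nat \<Rightarrow> 'a set" and rr :: "nat \<Rightarrow> nat"
    and indep_sets :: "'a set set"
  assumes "finite S"
    and "r \<le> card S"
    and "\<And>i. 1 \<le> i \<Longrightarrow> i \<le> q \<Longrightarrow> H i \<subseteq> S"
    and "\<And>i j. 1 \<le> i \<Longrightarrow> i < j \<Longrightarrow> j \<le> q \<Longrightarrow>
      int (card (H i \<inter> H j)) \<le> int (rr i) + int (rr j) - int r"
    and "indep_sets =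
      {X. X \<subseteq> S \<and> card X \<le> r \<and> (\<forall>i\<in>{1..q}. card (X \<inter> H i) \<le> rr i)}"
  shows "matroid S indep_sets
    \<and> (\<forall>Z. Z \<subseteq> S \<longrightarrow> matroid_rank indep_sets Z =
        Min ({r, card Z} \<union> (\<lambda>i. card (Z - H i) + rr i) ` {1..q}))
    \<and> ((\<forall>i\<in>{1..q}. r \<le> card (S - H i) + rr i) \<longrightarrow> matroid_rank indep_sets S = r)"
proof (intro conjI allI impI)
  have indep: "indep_sets = capped_sets S r {1..q} H rr"
    using assms(5) by (simp add: capped_sets_def)
  have HS: "H i \<subseteq> S" if "i \<in> {1..q}" for i using assms(3) that by simp
  have overlap: "r + card (H i \<inter> H j) \<le> rr i + rr j"
    if "i \<in> {1..q}" "j \<in> {1..q}" "i \<noteq> j" for i j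
  proof (cases "i < j")
    case True
    then show ?thesis using assms(4)[of i j] that by simp
  next
    case False
    then show ?thesis using assms(4)[of j i] that by (simp add: Int_commute)
  qed
  show "matroid S indep_sets"
    unfolding indep using matroid_capped_sets[OF assms(1) HS overlap] .
  show rank: "matroid_rank indep_sets Z =
      Min ({r, card Z} \<union> (\<lambda>i. card (Z - H i) + rr i) ` {1..q})" if "Z \<subseteq> S" for Z
    unfolding indep rank_bounds_def[symmetric]
    using matroid_rank_capped_sets[OF assms(1) finite_atLeastAtMost that HS overlap] .
  assume large: "\<forall>i\<in>{1..q}. r \<le> card (S - H i) + rr i"
  have "Min ({r, card S} \<union> (\<lambda>i. card (S - H i) + rr i) ` {1..q}) = r"
    using large assms(2) by (intro Min_eqI) auto
  then show "matroid_rank indep_sets S = r" using rank[OF subset_refl] by simp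
qed

end
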